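(* Let $U\subset\mathbb{R}^2$ be open, $\mathbf{x}:U\to\mathbb{R}^3$ a frontal and $\Omega:U\to\mathcal{M}_{3\times2}(\mathbb{R})$ a tangent moving base of $\mathbf{x}$. Then the matrices of the first and second fundamental forms of $\mathbf{x}$ decompose as $$\begin{pmatrix}E&F\\ F&G\end{pmatrix}=\Lambda\begin{pmatrix}E_\Omega&F_\Omega\\ F_\Omega&G_\Omega\end{pmatrix}\Lambda^T,\qquad\begin{pmatrix}e&f\\ f&g\end{pmatrix}=\Lambda\begin{pmatrix}e_\Omega&f_{1\Omega}\\ f_{2\Omega}&g_\Omega\end{pmatrix},$$ in which all components are smooth real functions on $U$, $E_\Omega>0$, $G_\Omega>0$, $E_\Omega G_\Omega-F_\Omega^2>0$, $\mathrm{rank}(D\mathbf{x})=\mathrm{rank}(\Lambda)$, $\Sigma(\mathbf{x})=\lambda_\Omega^{-1}(0)$, and $$\Lambda_{(1)u}\mathbf{I}_\Omega\Lambda_{(2)}^T-\Lambda_{(1)}\mathbf{I}_\Omega\Lambda_{(2)u}^T+E_v-F_u\in\mathfrak{T}_\Omega,$$ $$\Lambda_{(1)v}\mathbf{I}_\Omega\Lambda_{(2)}^T-\Lambda_{(1)}\mathbf{I}_\Omega\Lambda_{(2)v}^T+F_v-G_u\in\mathfrak{T}_\Omega.$$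
   Context: Smooth means $C^\infty$; subscripts $u,v$ denote (entrywise) partial derivatives; $\Lambda_{(i)}$ is the $i$-th row of $\Lambda$. $D\mathbf{f}$ is the Jacobian matrix. A smooth map $\mathbf{x}:U\to\mathbb{R}^3$ is a frontal if for every $p\in U$ there are an open neighborhood $V_p\subset U$ of $p$ and a smooth $\nu:V_p\to\mathbb{R}^3$ with $|\nu|=1$ and $\nu\cdot\mathbf{x}_u=\nu\cdot\mathbf{x}_v=0$ on $V_p$. A tangent moving base of $\mathbf{x}$ is a smooth map $\Omega=(\mathbf{w}_1\ \mathbf{w}_2):U\to\mathcal{M}_{3\times2}(\mathbb{R})$ whose columns are linearly independent at every point and such that $\mathbf{x}_u,\mathbf{x}_v\in\mathrm{span}(\mathbf{w}_1,\mathbf{w}_2)$ at every point. Given $\Omega$: $\mathbf{n}=\frac{\mathbf{w}_1\times\mathbf{w}_2}{\|\mathbf{w}_1\times\mathbf{w}_2\|}$; $\mathbf{I}_\Omega=\begin{pmatrix}E_\Omega&F_\Omega\\ F_\Omega&G_\Omega\end{pmatrix}:=\Omega^T\Omega$; $\mathbf{II}_\Omega=\begin{pmatrix}e_\Omega&f_{1\Omega}\\ f_{2\Omega}&g_\Omega\end{pmatrix}:=-\Omega^TD\mathbf{n}$; $\Lambda=(\lambda_{ij}):=D\mathbf{x}^T\,\Omega\,\mathbf{I}_\Omega^{-1}$ (so that $D\mathbf{x}=\Omega\Lambda^T$); $\lambda_\Omega:=\det\Lambda$; $\mathfrak{T}_\Omega$ is the principal ideal generated by $\lambda_\Omega$ in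 $C^\infty(U,\mathbb{R})$. $\Sigma(\mathbf{x})$ is the set of points of $U$ where $\mathbf{x}$ is not immersive. $E=\mathbf{x}_u\cdot\mathbf{x}_u$, $F=\mathbf{x}_u\cdot\mathbf{x}_v$, $G=\mathbf{x}_v\cdot\mathbf{x}_v$, $e=\mathbf{n}\cdot\mathbf{x}_{uu}$, $f=\mathbf{n}\cdot\mathbf{x}_{uv}$, $g=\mathbf{n}\cdot\mathbf{x}_{vv}$ (the unit normal used is always the one induced by $\Omega$). *)

theory Defs
  imports "HOL-Analysis.Analysis" "HOL-Algebra.Ideal"
begin

(* C^k and C^infinity maps on an open set S: f is C^(k+1) iff it is differentiable at every point
   of S and every directional derivative is C^k.  Only the values of f on S matter. *)

primrec Ck_on ::
  "nat \<Rightarrow> 'a::euclidean_space set \<Rightarrow> ('a \<Rightarrow> 'b::real_normed_vector) \<Rightarrow> bool" where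
  "Ck_on 0 S f \<longleftrightarrow> continuous_on S f"
| "Ck_on (Suc k) S f \<longleftrightarrow>
     (\<forall>p\<in>S. f differentiable (at p)) \<and>
     (\<forall>h. Ck_on k S (\<lambda>p. frechet_derivative f (at p) h))"

definition smooth_on :: "'a::euclidean_space set \<Rightarrow> ('a \<Rightarrow> 'b::real_normed_vector) \<Rightarrow> bool" where
  "smooth_on S f \<longleftrightarrow> (\<forall>k. Ck_on k S f)"

(* The coordinates of the plane are (u, v) = (p $ 1, p $ 2), so partial 1 is the subscript u and
   partial 2 the subscript v.  For vector- and matrix-valued maps this is the entrywise partial
   derivative. *)

definition partial :: "2 \<Rightarrow> (real^2 \<Rightarrow> 'b::real_normed_vector) \<Rightarrow> real^2 \<Rightarrow> 'b" where
  "partial i f p = frechet_derivative f (at p) (axis i 1)"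

definition mat2 :: "real \<Rightarrow> real \<Rightarrow> real \<Rightarrow> real \<Rightarrow> real^2^2" where
  "mat2 a b c d = vector [vector [a, b], vector [c, d]]"

(* The ring of smooth real functions on U; a function on U is represented by a total function
   that takes the default value outside U. *)

definition smooth_ring :: "(real^2) set \<Rightarrow> (real^2 \<Rightarrow> real) ring" where
  "smooth_ring U =
     \<lparr>carrier = {f \<in> extensional U. smooth_on U f},
      mult = (\<lambda>f g. \<lambda>p\<in>U. f p * g p),
      one = (\<lambda>p\<in>U. 1),
      zero = (\<lambda>p\<in>U. 0),
      add = (\<lambda>f g. \<lambda>p\<in>U. f p + g p)\<rparr>"

definition frontal :: "(real^2) set \<Rightarrow> (real^2 \<Rightarrow> real^3) \<Rightarrow> bool" where
  "frontal U x \<longleftrightarrow> smooth_on U x \<and>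
     (\<forall>p\<in>U. \<exists>V \<nu> :: real^2 \<Rightarrow> real^3. open V \<and> p \<in> V \<and> V \<subseteq> U \<and> smooth_on V \<nu> \<and>
        (\<forall>q\<in>V. norm (\<nu> q) = 1 \<and> \<nu> q \<bullet> partial 1 x q = 0 \<and> \<nu> q \<bullet> partial 2 x q = 0))"

(* The type real^2^3 consists of matrices with 3 rows and 2 columns.  The columns are required to be
   distinct because independence is a property of the set, which would collapse equal columns. *)

definition tangent_moving_base ::
  "(real^2) set \<Rightarrow> (real^2 \<Rightarrow> real^3) \<Rightarrow> (real^2 \<Rightarrow> real^2^3) \<Rightarrow> bool" where
  "tangent_moving_base U x \<Omega> \<longleftrightarrow> smooth_on U \<Omega> \<and>
     (\<forall>p\<in>U. column 1 (\<Omega> p) \<noteq> column 2 (\<Omega> p) \<and>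
        independent {column 1 (\<Omega> p), column 2 (\<Omega> p)} \<and>
        partial 1 x p \<in> span {column 1 (\<Omega> p), column 2 (\<Omega> p)} \<and>
        partial 2 x p \<in> span {column 1 (\<Omega> p), column 2 (\<Omega> p)})"

definition normal_of :: "(real^2 \<Rightarrow> real^2^3) \<Rightarrow> real^2 \<Rightarrow> real^3" where
  "normal_of \<Omega> p =
     (1 / norm (cross3 (column 1 (\<Omega> p)) (column 2 (\<Omega> p)))) *\<^sub>R
       cross3 (column 1 (\<Omega> p)) (column 2 (\<Omega> p))"

definition I_base :: "(real^2 \<Rightarrow> real^2^3) \<Rightarrow> real^2 \<Rightarrow> real^2^2" where
  "I_base \<Omega> p = transpose (\<Omega> p) ** \<Omega> p"

definition E_base :: "(real^2 \<Rightarrow> real^2^3) \<Rightarrow> real^2 \<Rightarrow> real" where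
  "E_base \<Omega> p = I_base \<Omega> p $ 1 $ 1"

definition F_base :: "(real^2 \<Rightarrow> real^2^3) \<Rightarrow> real^2 \<Rightarrow> real" where
  "F_base \<Omega> p = I_base \<Omega> p $ 1 $ 2"

definition G_base :: "(real^2 \<Rightarrow> real^2^3) \<Rightarrow> real^2 \<Rightarrow> real" where
  "G_base \<Omega> p = I_base \<Omega> p $ 2 $ 2"

definition II_base :: "(real^2 \<Rightarrow> real^2^3) \<Rightarrow> real^2 \<Rightarrow> real^2^2" where
  "II_base \<Omega> p = - (transpose (\<Omega> p) ** jacobian (normal_of \<Omega>) (at p))"

definition e_base :: "(real^2 \<Rightarrow> real^2^3) \<Rightarrow> real^2 \<Rightarrow> real" where
  "e_base \<Omega> p = II_base \<Omega> p $ 1 $ 1"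

definition f1_base :: "(real^2 \<Rightarrow> real^2^3) \<Rightarrow> real^2 \<Rightarrow> real" where
  "f1_base \<Omega> p = II_base \<Omega> p $ 1 $ 2"

definition f2_base :: "(real^2 \<Rightarrow> real^2^3) \<Rightarrow> real^2 \<Rightarrow> real" where
  "f2_base \<Omega> p = II_base \<Omega> p $ 2 $ 1"

definition g_base :: "(real^2 \<Rightarrow> real^2^3) \<Rightarrow> real^2 \<Rightarrow> real" where
  "g_base \<Omega> p = II_base \<Omega> p $ 2 $ 2"

definition Lambda :: "(real^2 \<Rightarrow> real^3) \<Rightarrow> (real^2 \<Rightarrow> real^2^3) \<Rightarrow> real^2 \<Rightarrow> real^2^2" where
  "Lambda x \<Omega> p =
     transpose (jacobian x (at p)) ** \<Omega> p ** matrix_inv (I_base \<Omega> p)"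

definition lambda_base :: "(real^2 \<Rightarrow> real^3) \<Rightarrow> (real^2 \<Rightarrow> real^2^3) \<Rightarrow> real^2 \<Rightarrow> real" where
  "lambda_base x \<Omega> p = det (Lambda x \<Omega> p)"

definition T_ideal ::
  "(real^2) set \<Rightarrow> (real^2 \<Rightarrow> real^3) \<Rightarrow> (real^2 \<Rightarrow> real^2^3) \<Rightarrow> (real^2 \<Rightarrow> real) set" where
  "T_ideal U x \<Omega> = PIdl\<^bsub>smooth_ring U\<^esub> (restrict (lambda_base x \<Omega>) U)"

definition singular_set :: "(real^2) set \<Rightarrow> (real^2 \<Rightarrow> real^3) \<Rightarrow> (real^2) set" where
  "singular_set U x = {p \<in> U. \<not> inj (frechet_derivative x (at p))}"

definition coeff_E :: "(real^2 \<Rightarrow> real^3) \<Rightarrow> real^2 \<Rightarrow> real" where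
  "coeff_E x p = partial 1 x p \<bullet> partial 1 x p"

definition coeff_F :: "(real^2 \<Rightarrow> real^3) \<Rightarrow> real^2 \<Rightarrow> real" where
  "coeff_F x p = partial 1 x p \<bullet> partial 2 x p"

definition coeff_G :: "(real^2 \<Rightarrow> real^3) \<Rightarrow> real^2 \<Rightarrow> real" where
  "coeff_G x p = partial 2 x p \<bullet> partial 2 x p"

definition coeff_e :: "(real^2 \<Rightarrow> real^3) \<Rightarrow> (real^2 \<Rightarrow> real^2^3) \<Rightarrow> real^2 \<Rightarrow> real" where
  "coeff_e x \<Omega> p = normal_of \<Omega> p \<bullet> partial 1 (partial 1 x) p"

(* x_uv: first differentiate in u, then in v. *)
definition coeff_f :: "(real^2 \<Rightarrow> real^3) \<Rightarrow> (real^2 \<Rightarrow> real^2^3) \<Rightarrow> real^2 \<Rightarrow> real" where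
  "coeff_f x \<Omega> p = normal_of \<Omega> p \<bullet> partial 2 (partial 1 x) p"

definition coeff_g :: "(real^2 \<Rightarrow> real^3) \<Rightarrow> (real^2 \<Rightarrow> real^2^3) \<Rightarrow> real^2 \<Rightarrow> real" where
  "coeff_g x \<Omega> p = normal_of \<Omega> p \<bullet> partial 2 (partial 2 x) p"

end

theory Submission
  imports Defs
begin

text \<open>
  Since \<open>D\<^bold>x = \<Omega> \<Lambda>\<^sup>T\<close> and \<open>\<Omega>\<close> has the left inverse \<open>I\<^sub>\<Omega>\<^sup>-\<^sup>1 \<Omega>\<^sup>T\<close>, ranks, singular points and the first
  fundamental form are read off from \<open>\<Lambda>\<close>; the second fundamental form is \<open>- D\<^bold>x\<^sup>T D\<^bold>n\<close>, obtained by
  differentiating \<open>\<^bold>n \<bullet> \<^bold>x\<^sub>u = \<^bold>n \<bullet> \<^bold>x\<^sub>v = 0\<close>.  For the last two relations, the symmetry of second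
  derivatives turns \<open>E\<^sub>v - F\<^sub>u\<close> into \<open>\<^bold>x\<^sub>u \<bullet> \<^bold>x\<^sub>v\<^sub>u - \<^bold>x\<^sub>u\<^sub>u \<bullet> \<^bold>x\<^sub>v\<close> and \<open>F\<^sub>v - G\<^sub>u\<close> into
  \<open>\<^bold>x\<^sub>u \<bullet> \<^bold>x\<^sub>v\<^sub>v - \<^bold>x\<^sub>u\<^sub>v \<bullet> \<^bold>x\<^sub>v\<close>.  Expanding with \<open>D\<^bold>x = \<Omega> \<Lambda>\<^sup>T\<close>, the terms containing derivatives of
  \<open>\<Lambda>\<close> cancel, and what remains is the value of the alternating form with matrix
  \<open>\<Omega>\<^sup>T \<Omega>\<^sub>k - \<Omega>\<^sub>k\<^sup>T \<Omega>\<close> on the two rows of \<open>\<Lambda>\<close>, a smooth multiple of \<open>det \<Lambda>\<close>.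
\<close>

subsection \<open>Smooth maps\<close>

lemma frechet_derivative_eqI:
  "(f has_derivative f') (at p) \<Longrightarrow> frechet_derivative f (at p) = f'"
  using frechet_derivative_at by metis

text \<open>On an open set the values of a map determine its derivatives, so the claim passes by
  induction to the directional derivatives. One direction suffices, since the hypotheses are
  symmetric in \<open>f\<close> and \<open>g\<close>.\<close>

lemma Ck_on_cong:
  assumes "open S" and "\<And>p. p \<in> S \<Longrightarrow> f p = g p"
  shows "Ck_on k S f \<longleftrightarrow> Ck_on k S g"
proof -
  have *: "Ck_on k S g" if "Ck_on k S f" "\<And>p. p \<in> S \<Longrightarrow> f p = g p" for f g :: "'a \<Rightarrow> 'b"
    using that
  proof (induction k arbitrary: f g)
    case 0
    then show ?case using continuous_on_cong by force
  next
    case (Suc k)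
    have D: "(g has_derivative frechet_derivative f (at p)) (at p)" if "p \<in> S" for p
      using Suc.prems that \<open>open S\<close>
      by (auto simp: frechet_derivative_works intro: has_derivative_transform_within_open)
    have "Ck_on k S (\<lambda>p. frechet_derivative g (at p) h)" for h
    proof (rule Suc.IH)
      show "Ck_on k S (\<lambda>p. frechet_derivative f (at p) h)"
        using Suc.prems by simp
      show "frechet_derivative f (at p) h = frechet_derivative g (at p) h" if "p \<in> S" for p
        using frechet_derivative_eqI[OF D[OF that]] by simp
    qed
    then show ?case using D by (auto simp: differentiable_def)
  qed
  show ?thesis using *[of f g] *[of g f] assms(2) by auto
qed

text \<open>By uniqueness of the derivative, any explicit formula for it may replace
  \<open>frechet_derivative\<close>. The closure lemmas below rest on this: each exhibits a
  derivative built from maps already known to be C^k.\<close>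

lemma Ck_on_SucI:
  assumes "open S"
    and "\<And>p. p \<in> S \<Longrightarrow> (f has_derivative f' p) (at p)"
    and "\<And>h. Ck_on k S (\<lambda>p. f' p h)"
  shows "Ck_on (Suc k) S f"
proof -
  have "Ck_on k S (\<lambda>p. frechet_derivative f (at p) h)" for h
    using assms(3)[of h] Ck_on_cong[OF assms(1)] frechet_derivative_eqI[OF assms(2)]
    by (smt (verit))
  then show ?thesis using assms(2) by (auto simp: differentiable_def)
qed

lemma Ck_on_Suc_has_derivative:
  "Ck_on (Suc k) S f \<Longrightarrow> p \<in> S \<Longrightarrow> (f has_derivative frechet_derivative f (at p)) (at p)"
  by (simp add: frechet_derivative_works)

lemma Ck_on_SucD: "Ck_on (Suc k) S f \<Longrightarrow> Ck_on k S f"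
proof (induction k arbitrary: f)
  case 0
  then show ?case
    by (simp add: continuous_at_imp_continuous_on differentiable_imp_continuous_within)
next
  case (Suc k)
  show ?case
    using Suc.prems Suc.IH by (subst Ck_on.simps(2), subst (asm) Ck_on.simps(2)) blast
qed

lemma Ck_on_const: "open S \<Longrightarrow> Ck_on k S (\<lambda>p. c)"
proof (induction k arbitrary: c)
  case (Suc k)
  then show ?case by (intro Ck_on_SucI[where f' = "\<lambda>p h. 0"]) auto
qed simp

lemma Ck_on_add:
  assumes "open S"
  shows "Ck_on k S f \<Longrightarrow> Ck_on k S g \<Longrightarrow> Ck_on k S (\<lambda>p. f p + g p)"
proof (induction k arbitrary: f g)
  case (Suc k)
  show ?case
    by (rule Ck_on_SucI[OF assms has_derivative_add])
      (use Suc in \<open>auto intro: Ck_on_Suc_has_derivative\<close>)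
qed (auto intro: continuous_intros)

lemma Ck_on_linear:
  assumes "open S" "bounded_linear L"
  shows "Ck_on k S f \<Longrightarrow> Ck_on k S (\<lambda>p. L (f p))"
proof (induction k arbitrary: f)
  case 0
  then show ?case using bounded_linear.continuous_on[OF assms(2)] by simp
next
  case (Suc k)
  show ?case
    by (rule Ck_on_SucI[OF assms(1) bounded_linear.has_derivative[OF assms(2)]])
      (use Suc in \<open>auto intro: Ck_on_Suc_has_derivative\<close>)
qed

text \<open>A single Leibniz rule serves products, scaling, inner products and the cross product.
  The undifferentiated factors reappear in the derivative, so their order is lowered by
  \<open>Ck_on_SucD\<close> before the induction hypothesis applies.\<close>

lemma Ck_on_bilinear:
  assumes "open S" "bounded_bilinear B"
  shows "Ck_on k S f \<Longrightarrow> Ck_on k S g \<Longrightarrow> Ck_on k S (\<lambda>p. B (f p) (g p))"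
proof (induction k arbitrary: f g)
  case 0
  then show ?case using bounded_bilinear.continuous_on[OF assms(2)] by simp
next
  case (Suc k)
  show ?case
  proof (rule Ck_on_SucI[OF assms(1)])
    show "((\<lambda>p. B (f p) (g p)) has_derivative
        (\<lambda>h. B (f p) (frechet_derivative g (at p) h) + B (frechet_derivative f (at p) h) (g p))) (at p)"
      if "p \<in> S" for p
      using that Suc.prems
      by (intro bounded_bilinear.FDERIV[OF assms(2)] Ck_on_Suc_has_derivative)
    show "Ck_on k S (\<lambda>p. B (f p) (frechet_derivative g (at p) h) + B (frechet_derivative f (at p) h) (g p))" for h
      using Suc.prems Ck_on_SucD[OF Suc.prems(1)] Ck_on_SucD[OF Suc.prems(2)]
      by (intro Ck_on_add assms Suc.IH) auto
  qed
qed

lemma Ck_on_inverse: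
  fixes f :: "'a::euclidean_space \<Rightarrow> real"
  assumes "open S" "\<And>p. p \<in> S \<Longrightarrow> f p \<noteq> 0"
  shows "Ck_on k S f \<Longrightarrow> Ck_on k S (\<lambda>p. inverse (f p))"
proof (induction k)
  case 0
  then show ?case using assms by (auto intro: continuous_intros)
next
  case (Suc k)
  have IH: "Ck_on k S (\<lambda>p. inverse (f p))"
    using Suc.IH Ck_on_SucD[OF Suc.prems] by simp
  show ?case
  proof (rule Ck_on_SucI[OF assms(1)])
    \<comment> \<open>The derivative is written as nested products in which
      \<open>inverse (f p)\<close> itself recurs, so that the induction hypothesis and the product
      rule show it to be C^k.\<close>
    show "((\<lambda>p. inverse (f p)) has_derivative
        (\<lambda>h. (inverse (f p) * inverse (f p)) * ((- 1) * frechet_derivative f (at p) h))) (at p)"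
      if "p \<in> S" for p
      using Ck_on_Suc_has_derivative[OF Suc.prems that] assms(2)[OF that]
      by (auto intro!: derivative_eq_intros)
    show "Ck_on k S (\<lambda>p. (inverse (f p) * inverse (f p)) * ((- 1) * frechet_derivative f (at p) h))" for h
      using Suc.prems
      by (intro Ck_on_bilinear[OF assms(1) bounded_bilinear_mult] IH Ck_on_const assms) auto
  qed
qed

text \<open>As for the inverse, the derivative is expressed through the function itself. Positivity
  keeps the argument away from 0, where the square root is not differentiable.\<close>

lemma Ck_on_sqrt:
  fixes f :: "'a::euclidean_space \<Rightarrow> real"
  assumes "open S" "\<And>p. p \<in> S \<Longrightarrow> f p > 0"
  shows "Ck_on k S f \<Longrightarrow> Ck_on k S (\<lambda>p. sqrt (f p))"
proof (induction k)
  case 0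
  then show ?case using assms by (auto intro: continuous_intros)
next
  case (Suc k)
  have IH: "Ck_on k S (\<lambda>p. sqrt (f p))"
    using Suc.IH Ck_on_SucD[OF Suc.prems] by simp
  show ?case
  proof (rule Ck_on_SucI[OF assms(1)])
    show "((\<lambda>p. sqrt (f p)) has_derivative
        (\<lambda>h. (1 / 2) * (inverse (sqrt (f p)) * frechet_derivative f (at p) h))) (at p)"
      if "p \<in> S" for p
      using Ck_on_Suc_has_derivative[OF Suc.prems that] assms(2)[OF that]
      by (auto intro!: derivative_eq_intros simp: divide_simps)
    have "Ck_on k S (\<lambda>p. inverse (sqrt (f p)))"
      using assms(2) by (intro Ck_on_inverse assms(1) IH) force
    then show "Ck_on k S (\<lambda>p. (1 / 2) * (inverse (sqrt (f p)) * frechet_derivative f (at p) h))" for h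
      using Suc.prems
      by (intro Ck_on_bilinear[OF assms(1) bounded_bilinear_mult] Ck_on_const assms) auto
  qed
qed

section \<open>Transfer of these properties to smooth maps\<close>

lemma smooth_on_has_derivative:
  "smooth_on S f \<Longrightarrow> p \<in> S \<Longrightarrow> (f has_derivative frechet_derivative f (at p)) (at p)"
  using Ck_on_Suc_has_derivative unfolding smooth_on_def by blast

lemma smooth_on_frechet_derivative:
  "smooth_on S f \<Longrightarrow> smooth_on S (\<lambda>p. frechet_derivative f (at p) h)"
  unfolding smooth_on_def using Ck_on.simps(2) by blast

lemma smooth_on_partial: "smooth_on U f \<Longrightarrow> smooth_on U (partial i f)"
  using smooth_on_frechet_derivative[of U f "axis i 1"] by (simp add: partial_def[abs_def])

lemma smooth_on_imp_continuous_on: "smooth_on S f \<Longrightarrow> continuous_on S f"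
  unfolding smooth_on_def using Ck_on.simps(1) by blast

lemma smooth_on_cong:
  "open S \<Longrightarrow> (\<And>p. p \<in> S \<Longrightarrow> f p = g p) \<Longrightarrow> smooth_on S f \<longleftrightarrow> smooth_on S g"
  unfolding smooth_on_def using Ck_on_cong by blast

lemma smooth_on_add:
  "open S \<Longrightarrow> smooth_on S f \<Longrightarrow> smooth_on S g \<Longrightarrow> smooth_on S (\<lambda>p. f p + g p)"
  unfolding smooth_on_def using Ck_on_add by blast

lemma smooth_on_linear:
  "open S \<Longrightarrow> bounded_linear L \<Longrightarrow> smooth_on S f \<Longrightarrow> smooth_on S (\<lambda>p. L (f p))"
  unfolding smooth_on_def using Ck_on_linear by blast

lemma smooth_on_minus: "open S \<Longrightarrow> smooth_on S f \<Longrightarrow> smooth_on S (\<lambda>p. - f p)"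
  by (rule smooth_on_linear[OF _ bounded_linear_minus[OF bounded_linear_ident]])

lemma smooth_on_diff:
  "open S \<Longrightarrow> smooth_on S f \<Longrightarrow> smooth_on S g \<Longrightarrow> smooth_on S (\<lambda>p. f p - g p)"
  using smooth_on_add[OF _ _ smooth_on_minus, of S f g] by simp

lemma smooth_on_bilinear:
  "open S \<Longrightarrow> bounded_bilinear B \<Longrightarrow> smooth_on S f \<Longrightarrow> smooth_on S g \<Longrightarrow>
    smooth_on S (\<lambda>p. B (f p) (g p))"
  unfolding smooth_on_def using Ck_on_bilinear by blast

lemmas smooth_on_mult = smooth_on_bilinear[OF _ bounded_bilinear_mult]
  and smooth_on_scaleR = smooth_on_bilinear[OF _ bounded_bilinear_scaleR]
  and smooth_on_inner = smooth_on_bilinear[OF _ bounded_bilinear_inner]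

lemma smooth_on_inverse:
  fixes f :: "'a::euclidean_space \<Rightarrow> real"
  shows "open S \<Longrightarrow> (\<And>p. p \<in> S \<Longrightarrow> f p \<noteq> 0) \<Longrightarrow> smooth_on S f \<Longrightarrow> smooth_on S (\<lambda>p. inverse (f p))"
  unfolding smooth_on_def using Ck_on_inverse by blast

lemma smooth_on_sqrt:
  fixes f :: "'a::euclidean_space \<Rightarrow> real"
  shows "open S \<Longrightarrow> (\<And>p. p \<in> S \<Longrightarrow> f p > 0) \<Longrightarrow> smooth_on S f \<Longrightarrow> smooth_on S (\<lambda>p. sqrt (f p))"
  unfolding smooth_on_def using Ck_on_sqrt by blast

lemma smooth_on_cross:
  "open S \<Longrightarrow> smooth_on S f \<Longrightarrow> smooth_on S g \<Longrightarrow> smooth_on S (\<lambda>p. cross3 (f p) (g p))"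
  using smooth_on_bilinear bilinear_cross bilinear_conv_bounded_bilinear by blast

lemma smooth_on_column:
  fixes A :: "'a::euclidean_space \<Rightarrow> real^'n^'m"
  shows "open S \<Longrightarrow> smooth_on S A \<Longrightarrow> smooth_on S (\<lambda>p. column j (A p))"
  by (rule smooth_on_linear)
    (auto simp: column_def vec_eq_iff linear_iff simp flip: linear_conv_bounded_linear)

subsection \<open>Symmetry of second derivatives\<close>

text \<open>The second difference over the parallelogram with corner \<open>p\<close> and sides
  \<open>t *\<^sub>R h\<close>, \<open>t *\<^sub>R k\<close> becomes a mixed second derivative at an
  interior point by two applications of the mean value theorem, first along \<open>h\<close>, then
  along \<open>k\<close>.\<close>

lemma second_difference_mean_value:
  fixes g :: "'a::euclidean_space \<Rightarrow> real"
  assumes "smooth_on S g" "0 < t"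
    and S: "\<And>a b. 0 \<le> a \<Longrightarrow> a \<le> t \<Longrightarrow> 0 \<le> b \<Longrightarrow> b \<le> t \<Longrightarrow> p + a *\<^sub>R h + b *\<^sub>R k \<in> S"
  obtains a b where "0 < a" "a < t" "0 < b" "b < t"
    "g (p + t *\<^sub>R h + t *\<^sub>R k) - g (p + t *\<^sub>R h) - g (p + t *\<^sub>R k) + g p =
      t * (t * frechet_derivative (\<lambda>q. frechet_derivative g (at q) h) (at (p + a *\<^sub>R h + b *\<^sub>R k)) k)"
proof -
  let ?D = "\<lambda>q. frechet_derivative g (at q)"
  \<comment> \<open>The second difference is \<open>?f t - ?f 0\<close>. The vanishing summand with
    factor 0 gives both terms of \<open>?f\<close> the shape treated in fact 1, with
    \<open>b = t\<close> and \<open>b = 0\<close>.\<close>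
  let ?f = "\<lambda>s. g (p + s *\<^sub>R h + t *\<^sub>R k) - g (p + s *\<^sub>R h + 0 *\<^sub>R k)"
  have 1: "((\<lambda>s. g (p + s *\<^sub>R h + b *\<^sub>R k)) has_real_derivative ?D (p + s *\<^sub>R h + b *\<^sub>R k) h) (at s)"
    if "0 \<le> s" "s \<le> t" "0 \<le> b" "b \<le> t" for s b
  proof -
    note d = smooth_on_has_derivative[OF assms(1) S[OF that]]
    have "((\<lambda>s. g (p + s *\<^sub>R h + b *\<^sub>R k)) has_derivative (\<lambda>r. ?D (p + s *\<^sub>R h + b *\<^sub>R k) (r *\<^sub>R h))) (at s)"
      by (rule has_derivative_compose[where f = "\<lambda>s. p + s *\<^sub>R h + b *\<^sub>R k", OF _ d])
        (auto intro!: derivative_eq_intros)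
    then show ?thesis
      using linear_cmul[OF has_derivative_linear[OF d]]
      by (simp add: has_field_derivative_def mult_commute_abs)
  qed
  have 2: "((\<lambda>s. ?D (p + a *\<^sub>R h + s *\<^sub>R k) h) has_real_derivative
      frechet_derivative (\<lambda>q. ?D q h) (at (p + a *\<^sub>R h + s *\<^sub>R k)) k) (at s)"
    if "0 \<le> a" "a \<le> t" "0 \<le> s" "s \<le> t" for s a
  proof -
    note d = smooth_on_has_derivative[OF smooth_on_frechet_derivative[OF assms(1)] S[OF that]]
    have "((\<lambda>s. ?D (p + a *\<^sub>R h + s *\<^sub>R k) h) has_derivative
        (\<lambda>r. frechet_derivative (\<lambda>q. ?D q h) (at (p + a *\<^sub>R h + s *\<^sub>R k)) (r *\<^sub>R k))) (at s)"
      by (rule has_derivative_compose[where f = "\<lambda>s. p + a *\<^sub>R h + s *\<^sub>R k", OF _ d])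
        (auto intro!: derivative_eq_intros)
    then show ?thesis
      using linear_cmul[OF has_derivative_linear[OF d]]
      by (simp add: has_field_derivative_def mult_commute_abs)
  qed
  have "\<exists>a>0. a < t \<and>
      ?f t - ?f 0 = (t - 0) * (?D (p + a *\<^sub>R h + t *\<^sub>R k) h - ?D (p + a *\<^sub>R h + 0 *\<^sub>R k) h)"
    by (rule MVT2[OF \<open>0 < t\<close>]) (rule DERIV_diff; rule 1; use \<open>0 < t\<close> in simp)
  then obtain a where a: "0 < a" "a < t"
    "?f t - ?f 0 = (t - 0) * (?D (p + a *\<^sub>R h + t *\<^sub>R k) h - ?D (p + a *\<^sub>R h + 0 *\<^sub>R k) h)"
    by blast
  have "\<exists>b>0. b < t \<and>
      ?D (p + a *\<^sub>R h + t *\<^sub>R k) h - ?D (p + a *\<^sub>R h + 0 *\<^sub>R k) h =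
      (t - 0) * frechet_derivative (\<lambda>q. ?D q h) (at (p + a *\<^sub>R h + b *\<^sub>R k)) k"
    by (rule MVT2[OF \<open>0 < t\<close>]) (rule 2; use a in simp)
  then obtain b where b: "0 < b" "b < t"
    "?D (p + a *\<^sub>R h + t *\<^sub>R k) h - ?D (p + a *\<^sub>R h + 0 *\<^sub>R k) h =
      (t - 0) * frechet_derivative (\<lambda>q. ?D q h) (at (p + a *\<^sub>R h + b *\<^sub>R k)) k"
    by blast
  show thesis
    by (rule that[of a b]) (use a b in \<open>auto simp: algebra_simps\<close>)
qed

text \<open>The second difference is symmetric in \<open>h\<close> and \<open>k\<close>, so the two
  mixed derivatives agree at suitable points arbitrarily close to \<open>p\<close>; continuity
  carries the equality to \<open>p\<close>.\<close>

lemma frechet_derivative_commute_real: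
  fixes g :: "'a::euclidean_space \<Rightarrow> real"
  assumes "open S" "smooth_on S g" "p \<in> S"
  shows "frechet_derivative (\<lambda>q. frechet_derivative g (at q) h) (at p) k =
    frechet_derivative (\<lambda>q. frechet_derivative g (at q) k) (at p) h"
proof -
  define G where "G h k = (\<lambda>p. frechet_derivative (\<lambda>q. frechet_derivative g (at q) h) (at p) k)" for h k
  have cont: "continuous_on S (G h k)" for h k
    unfolding G_def
    using assms(2) by (intro smooth_on_imp_continuous_on smooth_on_frechet_derivative)
  have "\<bar>G h k p - G k h p\<bar> \<le> e" if "e > 0" for e
  proof -
    have "\<forall>\<^sub>F q in at p. q \<in> S \<and> dist (G h k q) (G h k p) < e / 2 \<and> dist (G k h q) (G k h p) < e / 2"
    proof -
      have "(G h k \<longlongrightarrow> G h k p) (at p)" for h k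
        using cont[of h k] assms by (meson continuous_on_eq_continuous_at isCont_def)
      then show ?thesis
        using that assms by (intro eventually_conj tendstoD eventually_at_in_open') auto
    qed
    then obtain d where "d > 0" and d: "\<And>q. q \<noteq> p \<Longrightarrow> dist q p < d \<Longrightarrow>
        q \<in> S \<and> dist (G h k q) (G h k p) < e / 2 \<and> dist (G k h q) (G k h p) < e / 2"
      unfolding eventually_at by auto
    \<comment> \<open>The filter \<open>at p\<close> leaves out \<open>p\<close> itself, which is
      put back here.\<close>
    have d': "q \<in> S \<and> dist (G h k q) (G h k p) < e / 2 \<and> dist (G k h q) (G k h p) < e / 2"
      if "dist q p < d" for q
      using d[of q] that assms(3) \<open>e > 0\<close> by (cases "q = p") auto
    have pos: "norm h + norm k + 1 > 0"
      using norm_ge_zero[of h] norm_ge_zero[of k] by linarith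
    \<comment> \<open>This scale puts the whole parallelogram into the ball of radius
      \<open>d\<close> around \<open>p\<close>. The summand 1 keeps the denominator positive even
      for \<open>h = k = 0\<close> and makes the estimate strict.\<close>
    define t where "t = d / (norm h + norm k + 1)"
    have "t > 0" using \<open>d > 0\<close> pos by (simp add: t_def)
    have near: "dist (p + a *\<^sub>R h + b *\<^sub>R k) p < d"
      if "0 \<le> a" "a \<le> t" "0 \<le> b" "b \<le> t" for a b
    proof -
      have "dist (p + a *\<^sub>R h + b *\<^sub>R k) p \<le> a * norm h + b * norm k"
        using that norm_triangle_ineq[of "a *\<^sub>R h" "b *\<^sub>R k"] by (simp add: dist_norm add.assoc)
      also have "\<dots> \<le> t * norm h + t * norm k"
        using that by (intro add_mono mult_right_mono) auto
      also have "\<dots> < t * (norm h + norm k + 1)"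
        using \<open>t > 0\<close> by (simp add: distrib_left)
      also have "\<dots> = d"
        using pos by (simp add: t_def)
      finally show ?thesis .
    qed
    have near': "dist (p + a *\<^sub>R k + b *\<^sub>R h) p < d"
      if "0 \<le> a" "a \<le> t" "0 \<le> b" "b \<le> t" for a b
      using near[of b a] that by (simp add: add_ac)
    have G: "frechet_derivative (\<lambda>q. frechet_derivative g (at q) h) (at q) k = G h k q" for h k q
      by (simp add: G_def)
    obtain a b where ab: "0 < a" "a < t" "0 < b" "b < t"
      "g (p + t *\<^sub>R h + t *\<^sub>R k) - g (p + t *\<^sub>R h) - g (p + t *\<^sub>R k) + g p =
        t * (t * G h k (p + a *\<^sub>R h + b *\<^sub>R k))"
      by (rule second_difference_mean_value[OF assms(2) \<open>t > 0\<close>, of p h k, unfolded G])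
        (rule d'[THEN conjunct1], rule near)
    obtain a' b' where ab': "0 < a'" "a' < t" "0 < b'" "b' < t"
      "g (p + t *\<^sub>R k + t *\<^sub>R h) - g (p + t *\<^sub>R k) - g (p + t *\<^sub>R h) + g p =
        t * (t * G k h (p + a' *\<^sub>R k + b' *\<^sub>R h))"
      by (rule second_difference_mean_value[OF assms(2) \<open>t > 0\<close>, of p k h, unfolded G])
        (rule d'[THEN conjunct1], rule near')
    have swap: "p + t *\<^sub>R k + t *\<^sub>R h = p + t *\<^sub>R h + t *\<^sub>R k"
      by (simp add: add.assoc add.commute)
    have "t * (t * G h k (p + a *\<^sub>R h + b *\<^sub>R k)) = t * (t * G k h (p + a' *\<^sub>R k + b' *\<^sub>R h))"
      using ab(5) ab'(5) unfolding swap by linarith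
    then have "G h k (p + a *\<^sub>R h + b *\<^sub>R k) = G k h (p + a' *\<^sub>R k + b' *\<^sub>R h)"
      using \<open>t > 0\<close> by simp
    moreover have "\<bar>G h k (p + a *\<^sub>R h + b *\<^sub>R k) - G h k p\<bar> < e / 2"
      using d'[OF near[of a b]] ab(1-4) by (simp add: dist_real_def)
    moreover have "\<bar>G k h (p + a' *\<^sub>R k + b' *\<^sub>R h) - G k h p\<bar> < e / 2"
      using d'[OF near'[of a' b']] ab'(1-4) by (simp add: dist_real_def)
    ultimately show ?thesis by linarith
  qed
  then have "\<bar>G h k p - G k h p\<bar> \<le> 0" by (rule field_le_epsilon[of _ 0, simplified])
  then show ?thesis by (simp add: G_def)
qed

text \<open>Inner products with a fixed vector \<open>c\<close> commute with differentiation, which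
  reduces the claim to the real case; a vector is determined by all its inner products.\<close>

lemma frechet_derivative_commute:
  fixes f :: "'a::euclidean_space \<Rightarrow> 'b::real_inner"
  assumes "open S" "smooth_on S f" "p \<in> S"
  shows "frechet_derivative (\<lambda>q. frechet_derivative f (at q) h) (at p) k =
    frechet_derivative (\<lambda>q. frechet_derivative f (at q) k) (at p) h"
proof -
  have eq: "frechet_derivative (\<lambda>q. frechet_derivative f (at q) h) (at p) k \<bullet> c =
      frechet_derivative (\<lambda>q. frechet_derivative (\<lambda>r. f r \<bullet> c) (at q) h) (at p) k" for h k c
  proof -
    have 1: "frechet_derivative (\<lambda>r. f r \<bullet> c) (at q) h = frechet_derivative f (at q) h \<bullet> c" if "q \<in> S" for q
      unfolding frechet_derivative_eqI[OF bounded_linear.has_derivative[OF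
            bounded_linear_inner_left[of c] smooth_on_has_derivative[OF assms(2) that]]] ..
    note d = bounded_linear.has_derivative[OF bounded_linear_inner_left[of c]
        smooth_on_has_derivative[OF smooth_on_frechet_derivative[OF assms(2), of h] assms(3)]]
    have "((\<lambda>q. frechet_derivative (\<lambda>r. f r \<bullet> c) (at q) h) has_derivative
        (\<lambda>k. frechet_derivative (\<lambda>q. frechet_derivative f (at q) h) (at p) k \<bullet> c)) (at p)"
      by (rule has_derivative_transform_within_open[OF d assms(1,3)]) (rule 1[symmetric])
    from frechet_derivative_eqI[OF this] show ?thesis by simp
  qed
  have "frechet_derivative (\<lambda>q. frechet_derivative f (at q) h) (at p) k \<bullet> c =
      frechet_derivative (\<lambda>q. frechet_derivative f (at q) k) (at p) h \<bullet> c" for c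
    unfolding eq
    by (rule frechet_derivative_commute_real[OF assms(1) _ assms(3)])
      (rule smooth_on_linear[OF assms(1) bounded_linear_inner_left assms(2)])
  then show ?thesis using vector_eq_rdot by blast
qed

lemma partial_commute:
  fixes f :: "real^2 \<Rightarrow> 'b::real_inner"
  assumes "open U" "smooth_on U f" "p \<in> U"
  shows "partial i (partial j f) p = partial j (partial i f) p"
  using frechet_derivative_commute[OF assms] by (simp add: partial_def[abs_def])

section \<open>Calculus rules for partial derivatives and Jacobian matrices\<close>

lemma partial_cong:
  assumes "open S" "p \<in> S" "smooth_on S f" "\<And>q. q \<in> S \<Longrightarrow> f q = g q"
  shows "partial i f p = partial i g p"
  using frechet_derivative_eqI[OF has_derivative_transform_within_open[OF
        smooth_on_has_derivative[OF assms(3,2)] assms(1,2,4)]]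
  by (simp add: partial_def)

lemma partial_add:
  assumes "smooth_on S f" "smooth_on S g" "p \<in> S"
  shows "partial i (\<lambda>q. f q + g q) p = partial i f p + partial i g p"
  using frechet_derivative_eqI[OF has_derivative_add[OF
        smooth_on_has_derivative[OF assms(1,3)] smooth_on_has_derivative[OF assms(2,3)]]]
  by (simp add: partial_def)

lemma partial_linear:
  assumes "bounded_linear L" "smooth_on S f" "p \<in> S"
  shows "partial i (\<lambda>q. L (f q)) p = L (partial i f p)"
  using frechet_derivative_eqI[OF bounded_linear.has_derivative[OF assms(1)
        smooth_on_has_derivative[OF assms(2,3)]]]
  by (simp add: partial_def)

lemma partial_bilinear:
  assumes "bounded_bilinear B" "smooth_on S f" "smooth_on S g" "p \<in> S"
  shows "partial i (\<lambda>q. B (f q) (g q)) p = B (f p) (partial i g p) + B (partial i f p) (g p)"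
  using frechet_derivative_eqI[OF bounded_bilinear.FDERIV[OF assms(1)
        smooth_on_has_derivative[OF assms(2,4)] smooth_on_has_derivative[OF assms(3,4)]]]
  by (simp add: partial_def)

lemmas partial_scaleR = partial_bilinear[OF bounded_bilinear_scaleR]
  and partial_inner = partial_bilinear[OF bounded_bilinear_inner]

lemma jacobian_nth: "jacobian f (at p) $ k $ i = partial i f p $ k"
  by (simp add: jacobian_def matrix_def partial_def)

lemma column_jacobian: "column i (jacobian f (at p)) = partial i f p"
  by (simp add: vec_eq_iff column_def jacobian_nth)

lemma matrix_inv_mult:
  fixes A :: "real^'n^'n"
  assumes "invertible A"
  shows "A ** matrix_inv A = mat 1" "matrix_inv A ** A = mat 1"
  using someI_ex[OF assms[unfolded invertible_def]] by (auto simp: matrix_inv_def)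

subsection \<open>Tangent moving bases\<close>

lemma Gram_determinant_pos:
  fixes a b :: "'a::real_inner"
  assumes "a \<noteq> b" "independent {a, b}"
  shows "(a \<bullet> a) * (b \<bullet> b) - (a \<bullet> b)\<^sup>2 > 0"
proof -
  have "a \<noteq> 0" using assms dependent_zero[of "{a, b}"] by auto
  then have aa: "a \<bullet> a > 0" by simp
  \<comment> \<open>A division-free Gram-Schmidt step: \<open>v\<close> is
    \<open>a \<bullet> a\<close> times the component of \<open>b\<close> orthogonal to
    \<open>a\<close>, and its squared length is \<open>a \<bullet> a\<close> times the Gram
    determinant.\<close>
  define v where "v = (a \<bullet> a) *\<^sub>R b - (a \<bullet> b) *\<^sub>R a"
  have "v \<noteq> 0"
  proof
    assume "v = 0"
    then have "b = ((a \<bullet> b) / (a \<bullet> a)) *\<^sub>R a"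
      using aa by (simp add: v_def eq_vector_fraction_iff)
    then have "b \<in> span {a}" by (metis span_base span_scale singletonI)
    then show False
      using assms independent_insert[of b "{a}"] by (simp add: insert_commute)
  qed
  then have "0 < v \<bullet> v" by simp
  also have "v \<bullet> v = (a \<bullet> a) * ((a \<bullet> a) * (b \<bullet> b) - (a \<bullet> b)\<^sup>2)"
    by (simp add: v_def inner_simps inner_commute algebra_simps power2_eq_square)
  finally show ?thesis using aa by (simp add: zero_less_mult_iff)
qed

lemma I_base_nth: "I_base \<Omega> p $ i $ j = column i (\<Omega> p) \<bullet> column j (\<Omega> p)"
  by (simp add: I_base_def matrix_mult_transpose_dot_column)

lemma II_base_nth: "II_base \<Omega> p $ i $ j = - (column i (\<Omega> p) \<bullet> partial j (normal_of \<Omega>) p)"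
  by (simp add: II_base_def matrix_matrix_mult_def transpose_def inner_vec_def column_def
      jacobian_nth)

text \<open>Writes a row as a combination of constant vectors, so that smooth entries yield smooth
  rows.\<close>

lemma row_eq_axis_sum:
  fixes A :: "real^2^'n"
  shows "row i A = (A $ i $ 1) *\<^sub>R axis 1 1 + (A $ i $ 2) *\<^sub>R axis 2 1"
  by (simp add: vec_eq_iff row_def axis_def forall_2)

context
  fixes U :: "(real^2) set" and x :: "real^2 \<Rightarrow> real^3" and \<Omega> :: "real^2 \<Rightarrow> real^2^3"
  assumes open_U: "open U" and smooth_x: "smooth_on U x" and base: "tangent_moving_base U x \<Omega>"
begin

private abbreviation w :: "2 \<Rightarrow> real^2 \<Rightarrow> real^3" where "w j p \<equiv> column j (\<Omega> p)"

lemma smooth_base_column: "smooth_on U (w j)"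
  using base smooth_on_column[OF open_U] by (auto simp: tangent_moving_base_def)

lemma I_base_pos:
  assumes "p \<in> U"
  shows "E_base \<Omega> p > 0" "G_base \<Omega> p > 0" "E_base \<Omega> p * G_base \<Omega> p - (F_base \<Omega> p)\<^sup>2 > 0"
proof -
  have ind: "w 1 p \<noteq> w 2 p" "independent {w 1 p, w 2 p}"
    using base assms by (auto simp: tangent_moving_base_def)
  then have "w 1 p \<noteq> 0" "w 2 p \<noteq> 0" using dependent_zero[of "{w 1 p, w 2 p}"] by auto
  then show "E_base \<Omega> p > 0" "G_base \<Omega> p > 0"
    by (auto simp: E_base_def G_base_def I_base_nth)
  show "E_base \<Omega> p * G_base \<Omega> p - (F_base \<Omega> p)\<^sup>2 > 0"
    using Gram_determinant_pos[OF ind] by (simp add: E_base_def F_base_def G_base_def I_base_nth)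
qed

lemma invertible_I_base: "p \<in> U \<Longrightarrow> invertible (I_base \<Omega> p)"
  using I_base_pos(3)[of p]
  by (simp add: invertible_det_nz det_2 E_base_def F_base_def G_base_def I_base_nth
      inner_commute power2_eq_square)

lemma jacobian_eq:
  assumes "p \<in> U"
  shows "jacobian x (at p) = \<Omega> p ** transpose (Lambda x \<Omega> p)"
proof -
  have "\<exists>a b. partial i x p = a *\<^sub>R w 1 p + b *\<^sub>R w 2 p" for i
  proof -
    have "partial i x p \<in> span {w 1 p, w 2 p}"
      using base assms exhaust_2[of i] by (auto simp: tangent_moving_base_def)
    then obtain a b where "partial i x p = a *\<^sub>R w 1 p + b *\<^sub>R w 2 p"
      by (auto simp: span_breakdown_eq span_singleton algebra_simps)
    then show ?thesis by blast
  qed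
  then obtain a b where ab: "\<And>i. partial i x p = a i *\<^sub>R w 1 p + b i *\<^sub>R w 2 p"
    by metis
  \<comment> \<open>Column \<open>j\<close> of \<open>A\<close> holds the coordinates of
    \<open>partial j x\<close> in the base.\<close>
  define A :: "real^2^2" where "A = (\<chi> i j. if i = 1 then a j else b j)"
  have J: "jacobian x (at p) = \<Omega> p ** A"
    by (simp add: vec_eq_iff jacobian_nth ab matrix_matrix_mult_def sum_2 A_def column_def)
  have "Lambda x \<Omega> p = transpose A ** (I_base \<Omega> p ** matrix_inv (I_base \<Omega> p))"
    by (simp add: Lambda_def J matrix_transpose_mul matrix_mul_assoc I_base_def)
  then show ?thesis
    using matrix_inv_mult[OF invertible_I_base[OF assms]] J by simp
qed

lemma partial_x_eq:
  assumes "p \<in> U"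
  shows "partial i x p = Lambda x \<Omega> p $ i $ 1 *\<^sub>R w 1 p + Lambda x \<Omega> p $ i $ 2 *\<^sub>R w 2 p"
  unfolding column_jacobian[symmetric] jacobian_eq[OF assms]
  by (simp add: vec_eq_iff column_def matrix_matrix_mult_def transpose_def sum_2)

lemma smooth_I_base: "smooth_on U (\<lambda>p. I_base \<Omega> p $ i $ j)"
  unfolding I_base_nth by (intro smooth_on_inner open_U smooth_base_column)

text \<open>Row \<open>i\<close> of \<open>Lambda\<close> consists of the coordinates of
  \<open>partial i x\<close> in the base. Cramer's rule recovers them from the inner products with
  the base vectors; the denominator is the Gram determinant, which does not vanish. This gives
  explicit smooth formulas in place of \<open>matrix_inv\<close>.\<close>

lemma smooth_Lambda: "smooth_on U (\<lambda>p. Lambda x \<Omega> p $ i $ j)"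
proof -
  let ?a = "\<lambda>p. partial i x p \<bullet> w 1 p" and ?b = "\<lambda>p. partial i x p \<bullet> w 2 p"
  let ?d = "\<lambda>p. inverse ((w 1 p \<bullet> w 1 p) * (w 2 p \<bullet> w 2 p) - (w 1 p \<bullet> w 2 p) * (w 1 p \<bullet> w 2 p))"
  have pos: "(w 1 p \<bullet> w 1 p) * (w 2 p \<bullet> w 2 p) - (w 1 p \<bullet> w 2 p) * (w 1 p \<bullet> w 2 p) \<noteq> 0" if "p \<in> U" for p
    using I_base_pos(3)[OF that]
    by (simp add: E_base_def F_base_def G_base_def I_base_nth power2_eq_square)
  have "smooth_on U (\<lambda>p. ((w 2 p \<bullet> w 2 p) * ?a p - (w 1 p \<bullet> w 2 p) * ?b p) * ?d p)"
    "smooth_on U (\<lambda>p. ((w 1 p \<bullet> w 1 p) * ?b p - (w 1 p \<bullet> w 2 p) * ?a p) * ?d p)"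
    by (intro smooth_on_mult smooth_on_diff smooth_on_inverse smooth_on_inner smooth_on_partial
        smooth_base_column smooth_x open_U pos; assumption)+
  moreover have "((w 2 p \<bullet> w 2 p) * ?a p - (w 1 p \<bullet> w 2 p) * ?b p) * ?d p = Lambda x \<Omega> p $ i $ 1"
    "((w 1 p \<bullet> w 1 p) * ?b p - (w 1 p \<bullet> w 2 p) * ?a p) * ?d p = Lambda x \<Omega> p $ i $ 2"
    if "p \<in> U" for p
    using pos[OF that] unfolding partial_x_eq[OF that]
    by (simp_all add: inner_simps inner_commute field_simps)
  ultimately have "smooth_on U (\<lambda>p. Lambda x \<Omega> p $ i $ 1)" "smooth_on U (\<lambda>p. Lambda x \<Omega> p $ i $ 2)"
    using smooth_on_cong[OF open_U] by (smt (verit))+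
  then show ?thesis using exhaust_2[of j] by auto
qed

lemma smooth_row_Lambda: "smooth_on U (\<lambda>q. row i (Lambda x \<Omega> q))"
  unfolding row_eq_axis_sum smooth_on_def
  using smooth_Lambda[of i] unfolding smooth_on_def
  by (intro allI Ck_on_add open_U Ck_on_linear[OF open_U bounded_linear_scaleR_left]) auto

lemma partial_row_Lambda_nth:
  assumes "p \<in> U"
  shows "partial k (\<lambda>q. row i (Lambda x \<Omega> q)) p $ j = partial k (\<lambda>q. Lambda x \<Omega> q $ i $ j) p"
  using partial_linear[OF bounded_linear_vec_nth[of j] smooth_row_Lambda assms, of k i]
  by (simp add: row_def)

section \<open>The unit normal and the second fundamental form\<close>

lemma smooth_normal: "smooth_on U (normal_of \<Omega>)"
proof -
  let ?c = "\<lambda>p. cross3 (w 1 p) (w 2 p)"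
  have "?c p \<bullet> ?c p > 0" if "p \<in> U" for p
  proof -
    \<comment> \<open>Lagrange's identity: the squared length of the cross product is the Gram
      determinant, hence positive, and normalising preserves smoothness.\<close>
    have "?c p \<bullet> ?c p = (w 1 p \<bullet> w 1 p) * (w 2 p \<bullet> w 2 p) - (w 1 p \<bullet> w 2 p)\<^sup>2"
      using norm_cross_dot[of "w 1 p" "w 2 p"]
      by (simp add: power_mult_distrib dot_square_norm)
    then show ?thesis
      using I_base_pos(3)[OF that] by (simp add: E_base_def F_base_def G_base_def I_base_nth)
  qed
  moreover from this have "sqrt (?c p \<bullet> ?c p) \<noteq> 0" if "p \<in> U" for p
    using that by (metis less_numeral_extra(3) real_sqrt_eq_zero_cancel_iff)
  ultimately have "smooth_on U (\<lambda>p. inverse (sqrt (?c p \<bullet> ?c p)) *\<^sub>R ?c p)"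
    by (intro smooth_on_scaleR smooth_on_inverse smooth_on_sqrt smooth_on_inner smooth_on_cross
        smooth_base_column open_U)
  then show ?thesis
    by (simp add: normal_of_def[abs_def] norm_eq_sqrt_inner inverse_eq_divide)
qed

lemma normal_tangent:
  assumes "p \<in> U"
  shows "normal_of \<Omega> p \<bullet> partial i x p = 0"
  unfolding partial_x_eq[OF assms] normal_of_def by (simp add: inner_simps dot_cross_self)

lemma normal_second_partial:
  assumes "p \<in> U"
  shows "normal_of \<Omega> p \<bullet> partial j (partial i x) p =
    Lambda x \<Omega> p $ i $ 1 * II_base \<Omega> p $ 1 $ j + Lambda x \<Omega> p $ i $ 2 * II_base \<Omega> p $ 2 $ j"
proof -
  \<comment> \<open>The inner product vanishes on all of the open set \<open>U\<close>, so its
    derivative there is that of the zero function. The Leibniz rule then moves the derivative from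
    \<open>partial i x\<close> to the normal, with a change of sign.\<close>
  have "partial j (\<lambda>q. normal_of \<Omega> q \<bullet> partial i x q) p = partial j (\<lambda>q. 0) p"
    by (intro partial_cong[OF open_U assms] smooth_on_inner open_U smooth_normal smooth_on_partial
        smooth_x normal_tangent)
  then have "normal_of \<Omega> p \<bullet> partial j (partial i x) p = - (partial i x p \<bullet> partial j (normal_of \<Omega>) p)"
    unfolding partial_inner[OF smooth_normal smooth_on_partial[OF smooth_x] assms]
    by (simp add: partial_def inner_commute)
  then show ?thesis
    unfolding partial_x_eq[OF assms] by (simp add: II_base_nth inner_simps)
qed

section \<open>Rank and singular set\<close>

lemma Lambda_left_factor:
  assumes "p \<in> U"
  obtains B where "transpose (Lambda x \<Omega> p) = B ** jacobian x (at p)"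
proof
  \<comment> \<open>The witness for \<open>B\<close> is the left inverse of
    \<open>\<Omega> p\<close> furnished by the invertible Gram matrix.\<close>
  show "transpose (Lambda x \<Omega> p) =
      matrix_inv (I_base \<Omega> p) ** transpose (\<Omega> p) ** jacobian x (at p)"
    unfolding jacobian_eq[OF assms]
    using matrix_inv_mult(2)[OF invertible_I_base[OF assms]]
    by (metis I_base_def matrix_mul_assoc matrix_mul_lid)
qed

text \<open>The Jacobian and the transpose of \<open>Lambda\<close> are left multiples of each
  other, so neither rank exceeds the other.\<close>

lemma rank_jacobian: "p \<in> U \<Longrightarrow> rank (jacobian x (at p)) = rank (Lambda x \<Omega> p)"
  by (metis Lambda_left_factor jacobian_eq rank_mul_le_right rank_transpose order.antisym)

text \<open>Injectivity of the derivative means that the Jacobian has rank 2. This passes to the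
  square matrix \<open>Lambda\<close>, for which full rank means nonzero determinant.\<close>

lemma singular_set_eq: "singular_set U x = {p \<in> U. lambda_base x \<Omega> p = 0}"
proof -
  have "inj (frechet_derivative x (at p)) \<longleftrightarrow> lambda_base x \<Omega> p \<noteq> 0" if "p \<in> U" for p
  proof -
    have "frechet_derivative x (at p) = (*v) (jacobian x (at p))"
      using linear_frechet_derivative[of x "at p"] smooth_on_has_derivative[OF smooth_x that]
      by (auto simp: jacobian_def differentiable_def fun_eq_iff)
    then have "inj (frechet_derivative x (at p)) \<longleftrightarrow> rank (Lambda x \<Omega> p) = 2"
      using full_rank_injective[of "jacobian x (at p)"] rank_jacobian[OF that] by simp
    also have "\<dots> \<longleftrightarrow> lambda_base x \<Omega> p \<noteq> 0"
      using full_rank_injective[of "Lambda x \<Omega> p"]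
      by (simp add: lambda_base_def invertible_left_inverse
          matrix_left_invertible_injective flip: invertible_det_nz)
    finally show ?thesis .
  qed
  then show ?thesis by (auto simp: singular_set_def)
qed

section \<open>The two relations modulo the ideal generated by \<open>lambda_base\<close>\<close>

lemma compatibility_mod_lambda:
  assumes "p \<in> U"
  shows "(partial k (\<lambda>q. row 1 (Lambda x \<Omega> q)) p v* I_base \<Omega> p) \<bullet> row 2 (Lambda x \<Omega> p)
          - (row 1 (Lambda x \<Omega> p) v* I_base \<Omega> p) \<bullet> partial k (\<lambda>q. row 2 (Lambda x \<Omega> q)) p
          + (partial 1 x p \<bullet> partial k (partial 2 x) p - partial k (partial 1 x) p \<bullet> partial 2 x p)
    = (w 1 p \<bullet> partial k (w 2) p - partial k (w 1) p \<bullet> w 2 p) * lambda_base x \<Omega> p"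
proof -
  let ?a = "\<lambda>i j q. Lambda x \<Omega> q $ i $ j"
  \<comment> \<open>Leibniz rule for \<open>partial i x\<close> expanded in the base; it separates
    derivatives of the base vectors from derivatives of \<open>Lambda\<close>.\<close>
  have D: "partial k (partial i x) p =
      ?a i 1 p *\<^sub>R partial k (w 1) p + partial k (?a i 1) p *\<^sub>R w 1 p +
      (?a i 2 p *\<^sub>R partial k (w 2) p + partial k (?a i 2) p *\<^sub>R w 2 p)" for i
  proof -
    have "partial k (partial i x) p = partial k (\<lambda>q. ?a i 1 q *\<^sub>R w 1 q + ?a i 2 q *\<^sub>R w 2 q) p"
      by (intro partial_cong[OF open_U assms] partial_x_eq smooth_on_partial smooth_x)
    also have "\<dots> = partial k (\<lambda>q. ?a i 1 q *\<^sub>R w 1 q) p + partial k (\<lambda>q. ?a i 2 q *\<^sub>R w 2 q) p"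
      by (intro partial_add[OF _ _ assms] smooth_on_scaleR smooth_Lambda smooth_base_column open_U)
    finally show ?thesis
      by (simp add: partial_scaleR[OF smooth_Lambda smooth_base_column assms])
  qed
  show ?thesis
    \<comment> \<open>After expansion the derivatives of \<open>Lambda\<close> cancel against the
      first two summands. The diagonal terms vanish by symmetry of the inner product, and the two
      off-diagonal ones are opposite, which leaves the determinant as a factor.\<close>
    unfolding D partial_x_eq[OF assms]
    by (simp add: inner_vec_def[where 'b = 2] vector_matrix_mult_def sum_2 row_def
        partial_row_Lambda_nth[OF assms, unfolded row_def vec_lambda_eta] I_base_nth lambda_base_def det_2
        inner_simps inner_commute algebra_simps)
qed

text \<open>A principal ideal consists of the multiples of its generator, so membership amounts to
  exhibiting a smooth cofactor \<open>c\<close>.\<close>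

lemma mem_T_ideal:
  assumes "smooth_on U c" "\<And>p. p \<in> U \<Longrightarrow> f p = c p * lambda_base x \<Omega> p"
  shows "restrict f U \<in> T_ideal U x \<Omega>"
proof -
  \<comment> \<open>Restriction supplies the default value outside \<open>U\<close> that the carrier
    demands; smoothness on the open set \<open>U\<close> is unaffected.\<close>
  have "restrict c U \<in> carrier (smooth_ring U)"
    using assms(1) smooth_on_cong[OF open_U, of "restrict c U" c] by (simp add: smooth_ring_def)
  moreover have "restrict f U = restrict c U \<otimes>\<^bsub>smooth_ring U\<^esub> restrict (lambda_base x \<Omega>) U"
    using assms(2) by (auto simp: smooth_ring_def fun_eq_iff)
  ultimately show ?thesis by (auto simp: T_ideal_def cgenideal_def)
qed

text \<open>By the product rule and the symmetry of mixed derivatives, one of two equal mixed terms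
  cancels in each difference. Both results have the shape that
  \<open>compatibility_in_T_ideal\<close> expects, with \<open>k = 1\<close> and
  \<open>k = 2\<close>.\<close>

lemma partial_coeff:
  assumes "p \<in> U"
  shows "partial 2 (coeff_E x) p - partial 1 (coeff_F x) p =
      partial 1 x p \<bullet> partial 1 (partial 2 x) p - partial 1 (partial 1 x) p \<bullet> partial 2 x p"
    and "partial 2 (coeff_F x) p - partial 1 (coeff_G x) p =
      partial 1 x p \<bullet> partial 2 (partial 2 x) p - partial 2 (partial 1 x) p \<bullet> partial 2 x p"
  using partial_commute[OF open_U smooth_x assms, of 1 2]
  by (simp_all add: coeff_E_def[abs_def] coeff_F_def[abs_def] coeff_G_def[abs_def] inner_commute
      partial_inner[OF smooth_on_partial[OF smooth_x] smooth_on_partial[OF smooth_x] assms])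

text \<open>Treats both relations at once: \<open>b\<close> and \<open>c\<close> stand for
  \<open>E\<^sub>v\<close>, \<open>F\<^sub>u\<close> when \<open>k = 1\<close> and for
  \<open>F\<^sub>v\<close>, \<open>G\<^sub>u\<close> when \<open>k = 2\<close>.\<close>

lemma compatibility_in_T_ideal:
  assumes "\<And>p. p \<in> U \<Longrightarrow>
    b p - c p = partial 1 x p \<bullet> partial k (partial 2 x) p - partial k (partial 1 x) p \<bullet> partial 2 x p"
  shows "(\<lambda>p\<in>U. (partial k (\<lambda>q. row 1 (Lambda x \<Omega> q)) p v* I_base \<Omega> p) \<bullet> row 2 (Lambda x \<Omega> p)
          - (row 1 (Lambda x \<Omega> p) v* I_base \<Omega> p) \<bullet> partial k (\<lambda>q. row 2 (Lambda x \<Omega> q)) p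
          + b p - c p) \<in> T_ideal U x \<Omega>"
proof (rule mem_T_ideal)
  show "smooth_on U (\<lambda>p. w 1 p \<bullet> partial k (w 2) p - partial k (w 1) p \<bullet> w 2 p)"
    by (intro smooth_on_diff smooth_on_inner smooth_on_partial smooth_base_column open_U)
qed (use compatibility_mod_lambda[where k = k] assms in \<open>simp flip: add_diff_eq\<close>)

end

theorem theorem3p5:
  fixes U :: "(real^2) set" and x :: "real^2 \<Rightarrow> real^3" and \<Omega> :: "real^2 \<Rightarrow> real^2^3"
  assumes "open U" and "frontal U x" and "tangent_moving_base U x \<Omega>"
  shows
    "(\<forall>p\<in>U. mat2 (coeff_E x p) (coeff_F x p) (coeff_F x p) (coeff_G x p) =
        Lambda x \<Omega> p **
          mat2 (E_base \<Omega> p) (F_base \<Omega> p) (F_base \<Omega> p) (G_base \<Omega> p) **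
          transpose (Lambda x \<Omega> p)) \<and>
     (\<forall>p\<in>U. mat2 (coeff_e x \<Omega> p) (coeff_f x \<Omega> p) (coeff_f x \<Omega> p) (coeff_g x \<Omega> p) =
        Lambda x \<Omega> p **
          mat2 (e_base \<Omega> p) (f1_base \<Omega> p) (f2_base \<Omega> p) (g_base \<Omega> p)) \<and>
     smooth_on U (coeff_E x) \<and> smooth_on U (coeff_F x) \<and> smooth_on U (coeff_G x) \<and>
     smooth_on U (coeff_e x \<Omega>) \<and> smooth_on U (coeff_f x \<Omega>) \<and> smooth_on U (coeff_g x \<Omega>) \<and>
     smooth_on U (E_base \<Omega>) \<and> smooth_on U (F_base \<Omega>) \<and> smooth_on U (G_base \<Omega>) \<and>
     smooth_on U (e_base \<Omega>) \<and> smooth_on U (f1_base \<Omega>) \<and>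
     smooth_on U (f2_base \<Omega>) \<and> smooth_on U (g_base \<Omega>) \<and>
     (\<forall>i j. smooth_on U (\<lambda>p. Lambda x \<Omega> p $ i $ j)) \<and>
     (\<forall>p\<in>U. E_base \<Omega> p > 0 \<and> G_base \<Omega> p > 0 \<and>
        E_base \<Omega> p * G_base \<Omega> p - (F_base \<Omega> p)\<^sup>2 > 0) \<and>
     (\<forall>p\<in>U. rank (jacobian x (at p)) = rank (Lambda x \<Omega> p)) \<and>
     singular_set U x = {p \<in> U. lambda_base x \<Omega> p = 0} \<and>
     (\<lambda>p\<in>U. (partial 1 (\<lambda>q. row 1 (Lambda x \<Omega> q)) p v* I_base \<Omega> p) \<bullet> row 2 (Lambda x \<Omega> p)
          - (row 1 (Lambda x \<Omega> p) v* I_base \<Omega> p) \<bullet> partial 1 (\<lambda>q. row 2 (Lambda x \<Omega> q)) p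
          + partial 2 (coeff_E x) p - partial 1 (coeff_F x) p) \<in> T_ideal U x \<Omega> \<and>
     (\<lambda>p\<in>U. (partial 2 (\<lambda>q. row 1 (Lambda x \<Omega> q)) p v* I_base \<Omega> p) \<bullet> row 2 (Lambda x \<Omega> p)
          - (row 1 (Lambda x \<Omega> p) v* I_base \<Omega> p) \<bullet> partial 2 (\<lambda>q. row 2 (Lambda x \<Omega> q)) p
          + partial 2 (coeff_F x) p - partial 1 (coeff_G x) p) \<in> T_ideal U x \<Omega>"
proof -
  have sx: "smooth_on U x" using assms(2) by (simp add: frontal_def)
  note * = assms(1) sx assms(3)
  note I = E_base_def F_base_def G_base_def and II = e_base_def f1_base_def f2_base_def g_base_def
  have I_form: "mat2 (coeff_E x p) (coeff_F x p) (coeff_F x p) (coeff_G x p) =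
      Lambda x \<Omega> p ** mat2 (E_base \<Omega> p) (F_base \<Omega> p) (F_base \<Omega> p) (G_base \<Omega> p) **
        transpose (Lambda x \<Omega> p)" if "p \<in> U" for p
    by (simp add: vec_eq_iff forall_2 mat2_def matrix_matrix_mult_def transpose_def sum_2
        coeff_E_def coeff_F_def coeff_G_def I I_base_nth partial_x_eq[OF * that]
        inner_simps inner_commute algebra_simps)
  have II_form: "mat2 (coeff_e x \<Omega> p) (coeff_f x \<Omega> p) (coeff_f x \<Omega> p) (coeff_g x \<Omega> p) =
      Lambda x \<Omega> p ** mat2 (e_base \<Omega> p) (f1_base \<Omega> p) (f2_base \<Omega> p) (g_base \<Omega> p)"
    if "p \<in> U" for p
  proof -
    \<comment> \<open>The two off-diagonal entries come from different orders of differentiation: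
      entry (1,2) from \<open>x\<^sub>u\<close> differentiated in v, entry (2,1) from
      \<open>x\<^sub>v\<close> differentiated in u. Both orders are needed to match
      \<open>normal_second_partial\<close>.\<close>
    have "coeff_f x \<Omega> p = normal_of \<Omega> p \<bullet> partial 1 (partial 2 x) p"
      using partial_commute[OF assms(1) sx that, of 1 2] by (simp add: coeff_f_def)
    moreover have "coeff_f x \<Omega> p = normal_of \<Omega> p \<bullet> partial 2 (partial 1 x) p"
      by (simp add: coeff_f_def)
    ultimately show ?thesis
      using normal_second_partial[OF * that]
      by (simp add: vec_eq_iff forall_2 mat2_def matrix_matrix_mult_def sum_2
          coeff_e_def coeff_g_def II)
  qed
  have smooth_I: "smooth_on U (coeff_E x)" "smooth_on U (coeff_F x)" "smooth_on U (coeff_G x)"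
    unfolding coeff_E_def[abs_def] coeff_F_def[abs_def] coeff_G_def[abs_def]
    by (intro smooth_on_inner smooth_on_partial assms sx)+
  have smooth_II: "smooth_on U (coeff_e x \<Omega>)" "smooth_on U (coeff_f x \<Omega>)" "smooth_on U (coeff_g x \<Omega>)"
    unfolding coeff_e_def[abs_def] coeff_f_def[abs_def] coeff_g_def[abs_def]
    by (intro smooth_on_inner smooth_on_partial smooth_normal[OF *] assms sx)+
  have smooth_I': "smooth_on U (E_base \<Omega>)" "smooth_on U (F_base \<Omega>)" "smooth_on U (G_base \<Omega>)"
    unfolding I[abs_def] by (rule smooth_I_base[OF *])+
  have smooth_II': "smooth_on U (e_base \<Omega>)" "smooth_on U (f1_base \<Omega>)"
    "smooth_on U (f2_base \<Omega>)" "smooth_on U (g_base \<Omega>)"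
    unfolding II[abs_def] II_base_nth
    by (intro smooth_on_minus smooth_on_inner smooth_on_partial smooth_normal[OF *] smooth_base_column[OF *] assms)+
  have "\<forall>p\<in>U. E_base \<Omega> p > 0 \<and> G_base \<Omega> p > 0 \<and> E_base \<Omega> p * G_base \<Omega> p - (F_base \<Omega> p)\<^sup>2 > 0"
    using I_base_pos[OF *] by blast
  then show ?thesis
    using I_form II_form smooth_I smooth_II smooth_I' smooth_II' smooth_Lambda[OF *]
      rank_jacobian[OF *] singular_set_eq[OF *]
      compatibility_in_T_ideal[OF * partial_coeff(1)[OF *]]
      compatibility_in_T_ideal[OF * partial_coeff(2)[OF *]]
    by (intro conjI ballI allI; (assumption | blast))
qed

end
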